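(* Let $E$ and $F$ be metric spaces, and assume that the set $\mathrm{Iso}((\mathrm{Lip}(E),\|\cdot\|_s),(\mathrm{Lip}(F),\|\cdot\|_s))$ is canonical. Then every weak-2-local $\mathrm{Iso}((\mathrm{Lip}(E),\|\cdot\|_s),(\mathrm{Lip}(F),\|\cdot\|_s))$-map $\Delta:\mathrm{Lip}(E)\to\mathrm{Lip}(F)$ is a linear map. Furthermore, the same holds when the norm $\|\cdot\|_s$ is replaced everywhere with the norm $\|\cdot\|_L$: if $\mathrm{Iso}((\mathrm{Lip}(E),\|\cdot\|_L),(\mathrm{Lip}(F),\|\cdot\|_L))$ is canonical, then every weak-2-local $\mathrm{Iso}((\mathrm{Lip}(E),\|\cdot\|_L),(\mathrm{Lip}(F),\|\cdot\|_L))$-map $\Delta:\mathrm{Lip}(E)\to\mathrm{Lip}(F)$ is a linear map.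
   Context: For a metric space $E$, $\mathrm{Lip}(E)$ is the space of all bounded Lipschitz functions $f:E\to\mathbb{C}$. Put $L(f)=\sup\{|f(x)-f(y)|/d(x,y): x,y\in E,\ x\ne y\}$, $\|f\|_L=\max\{L(f),\|f\|_\infty\}$ and $\|f\|_s=L(f)+\|f\|_\infty$; both are complete norms on $\mathrm{Lip}(E)$. For Banach spaces $X,Y$, $\mathrm{Iso}(X,Y)$ denotes the set of all surjective linear isometries from $X$ onto $Y$. When $\mathrm{Lip}(E)$ and $\mathrm{Lip}(F)$ are both equipped with the norm $\|\cdot\|_s$, or both equipped with the norm $\|\cdot\|_L$, an element $T$ of $\mathrm{Iso}(\mathrm{Lip}(E),\mathrm{Lip}(F))$ is canonical if there exist $\tau\in\mathbb{C}$ with $|\tau|=1$ and a surjective isometry $\varphi:F\to E$ with $T(f)(s)=\tau f(\varphi(s))$ for all $f\in\mathrm{Lip}(E)$, $s\in F$; the set $\mathrm{Iso}(\mathrm{Lip}(E),\mathrm{Lip}(F))$ is canonical if every one of its elements is canonical. A weak-2-local $\mathrm{Iso}(X,Y)$-map is a (not necessarily linear nor continuous) mapping $\Delta:X\to Y$ such that for each $x,y\in X$ and $\phi\in Y^*$ there exists $T_{x,y,\phi}\in\mathrm{Iso}(X,Y)$, depending on $x$, $y$ and $\phi$, with $\phi(\Delta(x))=\phi(T_{x,y,\phi}(x))$ and $\phi(\Delta(y))=\phi(T_{x,y,\phi}(y))$. *)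

theory Defs
  imports "HOL-Analysis.Analysis"
begin

typedef (overloaded) ('a::metric_space) lip =
  "{f :: 'a \<Rightarrow> complex. bounded (range f) \<and> (\<exists>C. C-lipschitz_on UNIV f)}"
  morphisms lip_fun Lip
proof (intro exI CollectI conjI)
  show "bounded (range (\<lambda>x::'a. 0::complex))"
    by (simp add: image_def)
  show "0-lipschitz_on UNIV (\<lambda>x::'a. 0::complex)"
    by (simp add: lipschitz_on_def)
qed

setup_lifting type_definition_lip

lemma bounded_range_add:
  fixes f g :: "'a \<Rightarrow> complex"
  assumes "bounded (range f)" "bounded (range g)"
  shows "bounded (range (\<lambda>x. f x + g x))"
proof -
  obtain B C where "\<And>x. cmod (f x) \<le> B" "\<And>x. cmod (g x) \<le> C"
    using assms unfolding bounded_iff by auto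
  then have "cmod (f x + g x) \<le> B + C" for x
    by (meson add_mono norm_triangle_ineq order_trans)
  then show ?thesis
    unfolding bounded_iff by blast
qed

lemma bounded_range_cmult:
  fixes f :: "'a \<Rightarrow> complex"
  assumes "bounded (range f)"
  shows "bounded (range (\<lambda>x. c * f x))"
proof -
  obtain B where "\<And>x. cmod (f x) \<le> B"
    using assms unfolding bounded_iff by auto
  then have "cmod (c * f x) \<le> cmod c * B" for x
    by (simp add: norm_mult mult_left_mono)
  then show ?thesis
    unfolding bounded_iff by blast
qed

lemma lipschitz_on_cmult_complex:
  fixes f :: "'a::metric_space \<Rightarrow> complex"
  assumes "C-lipschitz_on U f"
  shows "(cmod c * C)-lipschitz_on U (\<lambda>x. c * f x)"
proof (rule lipschitz_onI)
  show "dist (c * f x) (c * f y) \<le> cmod c * C * dist x y" if "x \<in> U" "y \<in> U" for x y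
  proof -
    have "dist (c * f x) (c * f y) = cmod c * dist (f x) (f y)"
      by (simp add: dist_norm norm_mult flip: right_diff_distrib)
    also have "\<dots> \<le> cmod c * (C * dist x y)"
      by (intro mult_left_mono lipschitz_onD[OF assms that]) simp
    finally show ?thesis by (simp add: mult.assoc)
  qed
  show "0 \<le> cmod c * C"
    using lipschitz_on_nonneg[OF assms] by simp
qed

instantiation lip :: (metric_space) ab_group_add
begin

lift_definition zero_lip :: "'a lip" is "\<lambda>x. 0"
  by (auto simp: image_def lipschitz_on_def)

lift_definition plus_lip :: "'a lip \<Rightarrow> 'a lip \<Rightarrow> 'a lip" is "\<lambda>f g x. f x + g x"
  by (blast intro: bounded_range_add lipschitz_on_add)

lift_definition uminus_lip :: "'a lip \<Rightarrow> 'a lip" is "\<lambda>f x. - f x"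
proof -
  fix f :: "'a \<Rightarrow> complex"
  assume "bounded (range f) \<and> (\<exists>C. C-lipschitz_on UNIV f)"
  then show "bounded (range (\<lambda>x. - f x)) \<and> (\<exists>C. C-lipschitz_on UNIV (\<lambda>x. - f x))"
    using bounded_range_cmult[of f "-1"] lipschitz_on_cmult_complex[of _ _ f "-1"] by auto
qed

lift_definition minus_lip :: "'a lip \<Rightarrow> 'a lip \<Rightarrow> 'a lip" is "\<lambda>f g x. f x - g x"
proof -
  fix f g :: "'a \<Rightarrow> complex"
  assume "bounded (range f) \<and> (\<exists>C. C-lipschitz_on UNIV f)"
    and "bounded (range g) \<and> (\<exists>C. C-lipschitz_on UNIV g)"
  then show "bounded (range (\<lambda>x. f x - g x)) \<and> (\<exists>C. C-lipschitz_on UNIV (\<lambda>x. f x - g x))"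
    using bounded_range_add[of f "\<lambda>x. - 1 * g x"] bounded_range_cmult[of g "-1"]
      lipschitz_on_diff[of _ UNIV f _ g] by auto
qed

instance
  by standard (transfer; simp add: algebra_simps)+

end

lift_definition scale_lip :: "complex \<Rightarrow> 'a::metric_space lip \<Rightarrow> 'a lip" is "\<lambda>c f x. c * f x"
  by (blast intro: bounded_range_cmult lipschitz_on_cmult_complex)

lemma vector_space_lip: "vector_space (scale_lip :: complex \<Rightarrow> 'a::metric_space lip \<Rightarrow> 'a lip)"
  by standard (transfer; simp add: algebra_simps)+

lemma vector_space_complex: "vector_space ((*) :: complex \<Rightarrow> complex \<Rightarrow> complex)"
  by standard (simp_all add: algebra_simps)

text \<open>
  The element 0 is inserted so that the supremum over the empty set is 0, which matters only
  for a one-point space; since all quotients are nonnegative it changes nothing otherwise.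
\<close>

definition lip_const :: "'a::metric_space lip \<Rightarrow> real" where
  "lip_const f = Sup (insert 0 {cmod (lip_fun f x - lip_fun f y) / dist x y | x y. x \<noteq> y})"

definition norm_sup :: "'a::metric_space lip \<Rightarrow> real" where
  "norm_sup f = (SUP x. cmod (lip_fun f x))"

definition norm_L :: "'a::metric_space lip \<Rightarrow> real" where
  "norm_L f = max (lip_const f) (norm_sup f)"

definition norm_s :: "'a::metric_space lip \<Rightarrow> real" where
  "norm_s f = lip_const f + norm_sup f"

text \<open>
  The same space carries two norms, so the norms are explicit arguments below instead of
  coming from the class \<^class>\<open>real_normed_vector\<close>. The scalar multiplications are explicit
  as well, since linearity is over the complex numbers.
\<close>

definition Iso ::
  "(complex \<Rightarrow> 'x::ab_group_add \<Rightarrow> 'x) \<Rightarrow> ('x \<Rightarrow> real) \<Rightarrow>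
   (complex \<Rightarrow> 'y::ab_group_add \<Rightarrow> 'y) \<Rightarrow> ('y \<Rightarrow> real) \<Rightarrow> ('x \<Rightarrow> 'y) set" where
  "Iso sX nX sY nY = {T. Vector_Spaces.linear sX sY T \<and> surj T \<and> (\<forall>x. nY (T x) = nX x)}"

definition dual_space ::
  "(complex \<Rightarrow> 'y::ab_group_add \<Rightarrow> 'y) \<Rightarrow> ('y \<Rightarrow> real) \<Rightarrow> ('y \<Rightarrow> complex) set" where
  "dual_space sY nY = {\<phi>. Vector_Spaces.linear sY (*) \<phi> \<and> (\<exists>K. \<forall>y. cmod (\<phi> y) \<le> K * nY y)}"

definition weak_2_local_Iso ::
  "(complex \<Rightarrow> 'x::ab_group_add \<Rightarrow> 'x) \<Rightarrow> ('x \<Rightarrow> real) \<Rightarrow>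
   (complex \<Rightarrow> 'y::ab_group_add \<Rightarrow> 'y) \<Rightarrow> ('y \<Rightarrow> real) \<Rightarrow> ('x \<Rightarrow> 'y) \<Rightarrow> bool" where
  "weak_2_local_Iso sX nX sY nY \<Delta> \<longleftrightarrow>
     (\<forall>x y. \<forall>\<phi>\<in>dual_space sY nY. \<exists>T\<in>Iso sX nX sY nY.
        \<phi> (\<Delta> x) = \<phi> (T x) \<and> \<phi> (\<Delta> y) = \<phi> (T y))"

definition canonical :: "('a::metric_space lip \<Rightarrow> 'b::metric_space lip) \<Rightarrow> bool" where
  "canonical T \<longleftrightarrow>
     (\<exists>\<tau> (\<phi> :: 'b \<Rightarrow> 'a). cmod \<tau> = 1 \<and> surj \<phi> \<and> (\<forall>s t. dist (\<phi> s) (\<phi> t) = dist s t) \<and>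
        (\<forall>f s. lip_fun (T f) s = \<tau> * lip_fun f (\<phi> s)))"

end

theory Submission
  imports Defs
begin

text \<open>
  Composing \<open>\<Delta>\<close> with a point evaluation on \<open>F\<close> gives a functional \<open>G\<close> such that any two
  functions \<open>f\<close>, \<open>g\<close> admit a unimodular \<open>\<tau>\<close> and a point \<open>p\<close> with \<open>G f = \<tau> * f p\<close> and
  \<open>G g = \<tau> * g p\<close>. If \<open>f\<close> is positive, comparison with the constant 1 forces \<open>\<tau> = G 1\<close>; adding
  a large constant extends this to real \<open>f\<close>. Hence, up to the factor \<open>G 1\<close>, \<open>G\<close> commutes with
  real and imaginary parts, and the pair \<open>u + v\<close>, \<open>u + \<i> * v\<close> with \<open>u\<close>, \<open>v\<close> real yields
  \<open>G (u + v) = G u + G v\<close>.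
\<close>

lemma bounded_range_lip_fun: "bounded (range (lip_fun f))"
  using lip_fun[of f] by simp

lemma norm_lip_fun_le_norm_sup: "cmod (lip_fun f x) \<le> norm_sup f"
proof -
  obtain B where "\<And>x. cmod (lip_fun f x) \<le> B"
    using bounded_range_lip_fun[of f] unfolding bounded_iff by auto
  then have "bdd_above (range (\<lambda>x. cmod (lip_fun f x)))"
    by (auto intro!: bdd_aboveI)
  then show ?thesis
    unfolding norm_sup_def by (rule cSUP_upper[OF UNIV_I])
qed

text \<open>A supremum of reals bounds its members only if the set is bounded above, which any
  Lipschitz constant of \<open>f\<close> ensures. This makes \<open>norm_s\<close> dominate
  \<open>norm_sup\<close>.\<close>

lemma lip_const_nonneg: "0 \<le> lip_const f"
proof -
  obtain C where C: "C-lipschitz_on UNIV (lip_fun f)"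
    using lip_fun[of f] by auto
  have "cmod (lip_fun f x - lip_fun f y) / dist x y \<le> C" if "x \<noteq> y" for x y
    using lipschitz_onD[OF C, of x y] that by (simp add: dist_norm field_simps)
  with lipschitz_on_nonneg[OF C]
  have "bdd_above (insert 0 {cmod (lip_fun f x - lip_fun f y) / dist x y | x y. x \<noteq> y})"
    by (intro bdd_aboveI[of _ C]) auto
  then show ?thesis
    unfolding lip_const_def by (rule cSup_upper[rotated]) simp
qed

lemmas lip_fun_simps = zero_lip.rep_eq plus_lip.rep_eq scale_lip.rep_eq

lift_definition const_lip :: "complex \<Rightarrow> 'a::metric_space lip" is "\<lambda>c x. c"
  by (auto simp: image_def lipschitz_on_def intro: exI[of _ 0])

text \<open>The real part stays complex-valued so that \<open>G\<close> can be applied to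
  it.\<close>

lift_definition Re_lip :: "'a::metric_space lip \<Rightarrow> 'a lip" is "\<lambda>f x. complex_of_real (Re (f x))"
proof -
  fix f :: "'a \<Rightarrow> complex"
  assume f: "bounded (range f) \<and> (\<exists>C. C-lipschitz_on UNIV f)"
  obtain B where "\<And>x. cmod (f x) \<le> B"
    using f unfolding bounded_iff by auto
  then have "cmod (complex_of_real (Re (f x))) \<le> B" for x
    using order_trans[OF abs_Re_le_cmod] by simp
  then have "bounded (range (\<lambda>x. complex_of_real (Re (f x))))"
    unfolding bounded_iff by blast
  moreover have "C-lipschitz_on UNIV (\<lambda>x. complex_of_real (Re (f x)))"
    if "C-lipschitz_on UNIV f" for C
  proof (rule lipschitz_onI)
    fix x y
    have "dist (complex_of_real (Re (f x))) (complex_of_real (Re (f y))) \<le> dist (f x) (f y)"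
      using abs_Re_le_cmod[of "f x - f y"] by (simp add: dist_norm flip: of_real_diff)
    also have "\<dots> \<le> C * dist x y"
      using lipschitz_onD[OF that] by simp
    finally show "dist (complex_of_real (Re (f x))) (complex_of_real (Re (f y))) \<le> C * dist x y" .
  qed (rule lipschitz_on_nonneg[OF that])
  ultimately show "bounded (range (\<lambda>x. complex_of_real (Re (f x)))) \<and>
      (\<exists>C. C-lipschitz_on UNIV (\<lambda>x. complex_of_real (Re (f x))))"
    using f by blast
qed

locale unimodular_2_local =
  fixes G :: "'a::metric_space lip \<Rightarrow> complex"
  assumes two_local: "\<exists>\<tau> p. cmod \<tau> = 1 \<and> G f = \<tau> * lip_fun f p \<and> G g = \<tau> * lip_fun g p"
begin

text \<open>One factor and one point serve both \<open>scale_lip c f\<close> and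
  \<open>f\<close>.\<close>

lemma homogeneous: "G (scale_lip c f) = c * G f"
  using two_local[of "scale_lip c f" f] by (auto simp: lip_fun_simps)

definition \<tau>\<^sub>0 :: complex where "\<tau>\<^sub>0 = G (const_lip 1)"

lemma norm_\<tau>\<^sub>0: "cmod \<tau>\<^sub>0 = 1"
  using two_local[of "const_lip 1" "const_lip 1"] by (auto simp: \<tau>\<^sub>0_def const_lip.rep_eq)

lemma two_local_positive:
  assumes "\<And>x. lip_fun h x = complex_of_real (k x)" and "\<And>x. k x > 0"
  shows "\<exists>p. G h = \<tau>\<^sub>0 * lip_fun h p \<and> G f = \<tau>\<^sub>0 * lip_fun f p"
proof -
  obtain q where q: "G h = \<tau>\<^sub>0 * lip_fun h q"
    using two_local[of h "const_lip 1"] by (auto simp: \<tau>\<^sub>0_def const_lip.rep_eq)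
  obtain \<tau> p where p: "cmod \<tau> = 1" "G h = \<tau> * lip_fun h p" "G f = \<tau> * lip_fun f p"
    using two_local by blast
  \<comment> \<open>Two representations of \<open>G h\<close>: taking moduli removes the unimodular
    factors, and the common positive value can then be cancelled.\<close>
  have eq: "\<tau>\<^sub>0 * complex_of_real (k q) = \<tau> * complex_of_real (k p)"
    using q p assms(1) by simp
  then have "cmod (\<tau>\<^sub>0 * complex_of_real (k q)) = cmod (\<tau> * complex_of_real (k p))"
    by simp
  then have "k q = k p"
    using assms(2)[of p] assms(2)[of q] by (simp add: norm_mult norm_\<tau>\<^sub>0 p(1))
  then have "\<tau> = \<tau>\<^sub>0"
    using eq assms(2)[of p] by simp
  then show ?thesis
    using p by blast
qed

lemma two_local_real:
  assumes real: "\<And>x. lip_fun r x = complex_of_real (k x)"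
  shows "\<exists>p. G r = \<tau>\<^sub>0 * lip_fun r p \<and> G f = \<tau>\<^sub>0 * lip_fun f p"
proof -
  obtain B where B: "\<And>x. cmod (lip_fun r x) \<le> B"
    using bounded_range_lip_fun[of r] unfolding bounded_iff by auto
  \<comment> \<open>Since \<open>k\<close> is at least \<open>-B\<close>, the extra 1 makes
    \<open>h\<close> strictly positive.\<close>
  define h where "h = r + const_lip (complex_of_real (B + 1))"
  have h: "lip_fun h x = complex_of_real (k x + (B + 1))" for x
    by (simp add: h_def lip_fun_simps const_lip.rep_eq real)
  have pos: "k x + (B + 1) > 0" for x
    using B[of x] by (simp add: real)
  \<comment> \<open>Additivity is not yet available; the constant splits off because
    \<open>h\<close> and \<open>r\<close> are evaluated at a common point.\<close>
  have G_h: "G h = G r + \<tau>\<^sub>0 * complex_of_real (B + 1)"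
    using two_local_positive[OF h pos, of r] by (auto simp: h real algebra_simps)
  obtain p where "G h = \<tau>\<^sub>0 * lip_fun h p" "G f = \<tau>\<^sub>0 * lip_fun f p"
    using two_local_positive[OF h pos] by blast
  then show ?thesis
    using G_h by (auto simp: h real algebra_simps intro!: exI[of _ p])
qed

text \<open>Pairing the real function \<open>Re_lip f\<close> with \<open>f\<close> gives one point
  \<open>p\<close> for both, and \<open>G f / \<tau>\<^sub>0\<close> is the value of
  \<open>f\<close> there.\<close>

lemma G_Re_lip: "G (Re_lip f) = \<tau>\<^sub>0 * complex_of_real (Re (G f / \<tau>\<^sub>0))"
proof -
  have "\<tau>\<^sub>0 \<noteq> 0"
    using norm_\<tau>\<^sub>0 by auto
  then show ?thesis
    using two_local_real[of "Re_lip f" "\<lambda>x. Re (lip_fun f x)" f]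
    by (auto simp: Re_lip.rep_eq)
qed

lemma G_Re_lip_add: "G (Re_lip f + Re_lip g) = G (Re_lip f) + G (Re_lip g)"
proof -
  have nz: "\<tau>\<^sub>0 \<noteq> 0"
    using norm_\<tau>\<^sub>0 by auto
  \<comment> \<open>Two-locality handles only two functions at a time, so \<open>w\<close> packs
    both summands into one; the real sum is the other member of the pair.\<close>
  define w where "w = Re_lip f + scale_lip \<i> (Re_lip g)"
  have w: "lip_fun w x = Complex (Re (lip_fun f x)) (Re (lip_fun g x))" for x
    by (simp add: w_def lip_fun_simps Re_lip.rep_eq complex_eq_iff)
  have sum: "lip_fun (Re_lip f + Re_lip g) x =
      complex_of_real (Re (lip_fun f x) + Re (lip_fun g x))" for x
    by (simp add: lip_fun_simps Re_lip.rep_eq)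
  obtain p where p: "G (Re_lip f + Re_lip g) = \<tau>\<^sub>0 * lip_fun (Re_lip f + Re_lip g) p"
      "G w = \<tau>\<^sub>0 * lip_fun w p"
    using two_local_real[OF sum] by blast
  have "Re_lip w = Re_lip f" "Re_lip (scale_lip (- \<i>) w) = Re_lip g"
    by (simp_all flip: lip_fun_inject add: fun_eq_iff lip_fun_simps Re_lip.rep_eq w)
  then have "G (Re_lip f) = \<tau>\<^sub>0 * complex_of_real (Re (lip_fun f p))"
    and "G (Re_lip g) = \<tau>\<^sub>0 * complex_of_real (Re (lip_fun g p))"
    using G_Re_lip[of w] G_Re_lip[of "scale_lip (- \<i>) w"] nz
    by (simp_all add: homogeneous p(2) w)
  then show ?thesis
    by (simp add: p(1) sum algebra_simps)
qed

lemma additive: "G (f + g) = G f + G g"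
proof -
  have nz: "\<tau>\<^sub>0 \<noteq> 0"
    using norm_\<tau>\<^sub>0 by auto
  have Re_add: "Re (G (f + g) / \<tau>\<^sub>0) = Re (G f / \<tau>\<^sub>0) + Re (G g / \<tau>\<^sub>0)" for f g
  proof -
    have "Re_lip (f + g) = Re_lip f + Re_lip g"
      by (simp flip: lip_fun_inject add: fun_eq_iff lip_fun_simps Re_lip.rep_eq)
    then have "G (Re_lip (f + g)) = G (Re_lip f) + G (Re_lip g)"
      by (simp add: G_Re_lip_add)
    then have "\<tau>\<^sub>0 * complex_of_real (Re (G (f + g) / \<tau>\<^sub>0)) =
        \<tau>\<^sub>0 * complex_of_real (Re (G f / \<tau>\<^sub>0) + Re (G g / \<tau>\<^sub>0))"
      by (simp add: G_Re_lip distrib_left)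
    then show ?thesis
      using nz by (simp only: mult_cancel_left of_real_eq_iff) simp
  qed
  \<comment> \<open>Multiplying by \<open>- \<i>\<close> turns imaginary parts into real parts, and
    homogeneity carries the factor through \<open>G\<close>.\<close>
  have scale: "scale_lip (- \<i>) (f + g) = scale_lip (- \<i>) f + scale_lip (- \<i>) g"
    by (simp flip: lip_fun_inject add: fun_eq_iff lip_fun_simps algebra_simps)
  have "Im (G (f + g) / \<tau>\<^sub>0) = Im (G f / \<tau>\<^sub>0) + Im (G g / \<tau>\<^sub>0)"
    using Re_add[of "scale_lip (- \<i>) f" "scale_lip (- \<i>) g"]
    unfolding scale[symmetric] homogeneous times_divide_eq_right[symmetric]
    by (simp del: times_divide_eq_right)
  with Re_add[of f g] have "G (f + g) / \<tau>\<^sub>0 = G f / \<tau>\<^sub>0 + G g / \<tau>\<^sub>0"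
    by (simp add: complex_eq_iff)
  then show ?thesis
    using nz by (simp flip: add_divide_distrib)
qed

end

lemma evaluation_in_dual_space:
  assumes "\<And>f. norm_sup f \<le> N f"
  shows "(\<lambda>f. lip_fun f s) \<in> dual_space scale_lip N"
proof -
  have "cmod (lip_fun f s) \<le> N f" for f
    using order_trans[OF norm_lip_fun_le_norm_sup assms] .
  then show ?thesis
    unfolding dual_space_def Vector_Spaces.linear_iff
    by (auto simp: vector_space_lip vector_space_complex lip_fun_simps intro!: exI[of _ 1])
qed

text \<open>Point evaluations are bounded for every \<open>N\<close> above \<open>norm_sup\<close>,
  so one argument covers both norms. As evaluations separate functions, linearity is checked at each
  \<open>s\<close>.\<close>

lemma linear_if_weak_2_local_Iso:
  fixes \<Delta> :: "'a::metric_space lip \<Rightarrow> 'b::metric_space lip"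
  assumes norm: "\<And>f. norm_sup f \<le> N f"
    and canonical: "\<forall>T\<in>Iso scale_lip M scale_lip N. canonical T"
    and \<Delta>: "weak_2_local_Iso scale_lip M scale_lip N \<Delta>"
  shows "Vector_Spaces.linear scale_lip scale_lip \<Delta>"
proof -
  have G: "unimodular_2_local (\<lambda>f. lip_fun (\<Delta> f) s)" for s
  proof
    fix f g
    obtain T where "T \<in> Iso scale_lip M scale_lip N"
        and T: "lip_fun (\<Delta> f) s = lip_fun (T f) s" "lip_fun (\<Delta> g) s = lip_fun (T g) s"
      using \<Delta>[unfolded weak_2_local_Iso_def, rule_format, where x = f and y = g,
          OF evaluation_in_dual_space[OF norm]] by blast
    then have "canonical T"
      using canonical by blast
    then show "\<exists>\<tau> p. cmod \<tau> = 1 \<and> lip_fun (\<Delta> f) s = \<tau> * lip_fun f p \<and>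
        lip_fun (\<Delta> g) s = \<tau> * lip_fun g p"
      unfolding T canonical_def by blast
  qed
  have "\<Delta> (f + g) = \<Delta> f + \<Delta> g" for f g
    using unimodular_2_local.additive[OF G]
    by (simp flip: lip_fun_inject add: fun_eq_iff lip_fun_simps)
  moreover have "\<Delta> (scale_lip c f) = scale_lip c (\<Delta> f)" for c f
    using unimodular_2_local.homogeneous[OF G]
    by (simp flip: lip_fun_inject add: fun_eq_iff lip_fun_simps)
  ultimately show ?thesis
    unfolding Vector_Spaces.linear_iff by (simp add: vector_space_lip)
qed

theorem theorem3p4:
  shows
    "((\<forall>T\<in>Iso scale_lip (norm_s :: 'a::metric_space lip \<Rightarrow> real)
             scale_lip (norm_s :: 'b::metric_space lip \<Rightarrow> real). canonical T) \<longrightarrow>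
      (\<forall>\<Delta> :: 'a lip \<Rightarrow> 'b lip. weak_2_local_Iso scale_lip norm_s scale_lip norm_s \<Delta> \<longrightarrow>
         Vector_Spaces.linear scale_lip scale_lip \<Delta>)) \<and>
     ((\<forall>T\<in>Iso scale_lip (norm_L :: 'a lip \<Rightarrow> real)
             scale_lip (norm_L :: 'b lip \<Rightarrow> real). canonical T) \<longrightarrow>
      (\<forall>\<Delta> :: 'a lip \<Rightarrow> 'b lip. weak_2_local_Iso scale_lip norm_L scale_lip norm_L \<Delta> \<longrightarrow>
         Vector_Spaces.linear scale_lip scale_lip \<Delta>))"
proof -
  have "norm_sup f \<le> norm_s f" "norm_sup f \<le> norm_L f" for f :: "'b lip"
    using lip_const_nonneg[of f] by (simp_all add: norm_s_def norm_L_def)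
  then show ?thesis
    using linear_if_weak_2_local_Iso by blast
qed

end
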